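(* Let $r\ge 1$ be an integer and $\lambda_r\in\mathbb{C}\setminus\{0,1\}$. The connection coefficients $\lambda^{d}_{n,m}$ defined by $P^{d}_n(\lambda_r;r)(x)=\sum_{m=0}^{n}\lambda^{d}_{n,m}P_m(x)$, $n\ge 0$, are given, diagonal by diagonal, as follows. \begin{itemize} \item Diagonal $0$: $\lambda^{d}_{n,n}=1$ for $n\ge 0$. \item Diagonal $2i-1$, for each $1\le i\le r$: $\lambda^{d}_{n,n-2i+1}=0$ for $n\ge 2i-1$. \item Diagonal $2i$, for each $1\le i\le r$: $\lambda^{d}_{n,n-2i}=0$ for $2i\le n<r+i$, and $\lambda^{d}_{n,n-2i}=\dfrac{1-\lambda_r}{4^{i}}$ for $n\ge r+i$. \item Diagonal $m$, for each $m\ge 2r+1$: $\lambda^{d}_{n,n-m}=0$ for $n\ge m$. \end{itemize}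
   Context: $\{P_n\}_{n\ge0}$ denotes the monic Chebyshev polynomials of the second kind: $P_0=1$, $P_1=x$, $P_{n+2}(x)=xP_{n+1}(x)-\frac14P_n(x)$ for $n\ge 0$. For an integer $r\ge 1$ and $\lambda_r\in\mathbb{C}\setminus\{0,1\}$, the $r$th-perturbed sequence by dilatation $\{P^d_n(\lambda_r;r)\}_{n\ge 0}$ is the monic sequence with $P^d_0=1$, $P^d_1(x)=x$, $P^d_{n+2}(x)=xP^d_{n+1}(x)-\gamma_{n+1}P^d_n(x)$ for $n\ge 0$, where $\gamma_r=\lambda_r/4$ and $\gamma_{n+1}=1/4$ for $n\ge 0$, $n\ne r-1$. *)

theory Defs
  imports Complex_Main "HOL-Computational_Algebra.Polynomial"
begin

fun chebU :: "nat \<Rightarrow> complex poly" where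
  "chebU 0 = 1"
| "chebU (Suc 0) = [:0, 1:]"
| "chebU (Suc (Suc n)) = [:0, 1:] * chebU (Suc n) - smult (1/4) (chebU n)"

text \<open>Recurrence coefficients \<open>\<gamma>\<^sub>k\<close>, \<open>k \<ge> 1\<close>, of the sequence perturbed by dilatation at
  order \<open>r\<close>; the value at \<open>k = 0\<close> is never used.\<close>

definition dil_gamma :: "complex \<Rightarrow> nat \<Rightarrow> nat \<Rightarrow> complex" where
  "dil_gamma lam r k = (if k = r then lam / 4 else 1 / 4)"

fun chebU_dil :: "complex \<Rightarrow> nat \<Rightarrow> nat \<Rightarrow> complex poly" where
  "chebU_dil lam r 0 = 1"
| "chebU_dil lam r (Suc 0) = [:0, 1:]"
| "chebU_dil lam r (Suc (Suc n)) =
     [:0, 1:] * chebU_dil lam r (Suc n) - smult (dil_gamma lam r (Suc n)) (chebU_dil lam r n)"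

text \<open>Connection coefficients of \<open>Q\<close> with respect to \<open>P\<close>. Only indices \<open>m \<le> n\<close> are meaningful;
  the coefficients with \<open>m > n\<close> are set to \<open>0\<close> so that the description is unique when \<open>P\<close> is a
  polynomial sequence with \<open>degree (P n) = n\<close>.\<close>

definition connection_coeff ::
    "(nat \<Rightarrow> complex poly) \<Rightarrow> (nat \<Rightarrow> complex poly) \<Rightarrow> nat \<Rightarrow> nat \<Rightarrow> complex" where
  "connection_coeff Q P n =
     (THE c. Q n = (\<Sum>m\<le>n. smult (c m) (P m)) \<and> (\<forall>m>n. c m = 0))"

end

theory Submission
  imports Defs
begin

text \<open>Once the perturbation at order \<open>r\<close> has been passed, \<open>P\<^sup>d\<close> satisfies the recurrence of \<open>P\<close>
  again, so comparing two consecutive terms gives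
  \<open>P\<^sup>d\<^sub>n = P\<^sub>n + (1 - \<lambda>)/4 P\<^bsub>r-1\<^esub> P\<^bsub>n-r-1\<^esub>\<close> for \<open>n > r\<close>. Iterating the identity
  \<open>P\<^bsub>a+1\<^esub> P\<^bsub>b+1\<^esub> = P\<^bsub>a+b+2\<^esub> + 1/4 P\<^sub>a P\<^sub>b\<close> linearises the product, and the coefficients
  can be read off.\<close>

text \<open>For fixed \<open>a\<close>, both sides obey the recurrence of \<open>chebU\<close> in
  \<open>b\<close>, so agreement at \<open>b = 0\<close> and \<open>b = 1\<close> suffices.\<close>

lemma chebU_mult_Suc:
  "chebU (Suc a) * chebU (Suc b) = chebU (Suc (Suc (a + b))) + smult (1/4) (chebU a * chebU b)"
proof (induction b rule: chebU.induct)
  case 1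
  show ?case by simp
next
  case 2
  show ?case by (simp add: algebra_simps)
next
  case (3 b)
  have "chebU (Suc a) * chebU (Suc (Suc (Suc b)))
      = [:0, 1:] * (chebU (Suc a) * chebU (Suc (Suc b)))
        - smult (1/4) (chebU (Suc a) * chebU (Suc b))"
    by (simp only: chebU.simps) (simp add: algebra_simps)
  also have "\<dots> = [:0, 1:] * (chebU (Suc (Suc (a + Suc b))) + smult (1/4) (chebU a * chebU (Suc b)))
        - smult (1/4) (chebU (Suc (Suc (a + b))) + smult (1/4) (chebU a * chebU b))"
    by (simp only: 3)
  also have "\<dots> = ([:0, 1:] * chebU (Suc (Suc (a + Suc b))) - smult (1/4) (chebU (Suc (Suc (a + b)))))
        + smult (1/4) (chebU a * ([:0, 1:] * chebU (Suc b) - smult (1/4) (chebU b)))"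
    by (simp del: chebU.simps add: algebra_simps smult_add_right smult_diff_right)
  also have "\<dots> = chebU (Suc (Suc (a + Suc (Suc b)))) + smult (1/4) (chebU a * chebU (Suc (Suc b)))"
    by (simp only: chebU.simps add_Suc_right)
  finally show ?case .
qed

lemma smult_sum_poly: "smult c (sum f A) = (\<Sum>x\<in>A. smult c (f x))"
  by (induction A rule: infinite_finite_induct) (simp_all add: smult_add_right)

lemma chebU_mult:
  "chebU a * chebU b = (\<Sum>j\<le>min a b. smult (1 / 4 ^ j) (chebU (a + b - 2 * j)))"
proof (induction a b rule: diff_induct)
  case (3 a b)
  have "(\<Sum>j\<le>min (Suc a) (Suc b). smult (1 / 4 ^ j) (chebU (Suc a + Suc b - 2 * j)))
      = chebU (Suc (Suc (a + b)))
        + smult (1/4) (\<Sum>j\<le>min a b. smult (1 / 4 ^ j) (chebU (a + b - 2 * j)))"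
    \<comment> \<open>The summand \<open>j = 0\<close> is the leading term; shifting
      \<open>j\<close> by one turns the rest into \<open>1/4\<close> times the sum for
      \<open>a\<close> and \<open>b\<close>.\<close>
    unfolding min_Suc_Suc sum.atMost_Suc_shift smult_sum_poly
    by (simp del: chebU.simps)
  then show ?case
    by (simp only: chebU_mult_Suc 3)
qed simp_all

lemma chebU_dil_eq_chebU: "n \<le> r \<Longrightarrow> chebU_dil lam r n = chebU n"
  by (induction n rule: chebU.induct) (simp_all add: dil_gamma_def)

text \<open>The perturbed coefficient enters only at \<open>k = 0\<close>, where
  \<open>lam/4\<close> replaces \<open>1/4\<close> in front of \<open>chebU s\<close>. From there on
  both sides follow the recurrence of \<open>chebU\<close> in \<open>k\<close>. Writing the order as
  \<open>Suc s\<close> avoids truncated subtraction.\<close>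

lemma chebU_dil_eq_product:
  "chebU_dil lam (Suc s) (Suc (Suc (s + k)))
    = chebU (Suc (Suc (s + k))) + smult ((1 - lam) / 4) (chebU s * chebU k)"
proof (induction k rule: chebU.induct)
  case 1
  show ?case
    by (simp add: dil_gamma_def chebU_dil_eq_chebU algebra_simps smult_diff_left diff_divide_distrib)
next
  case 2
  show ?case
    by (simp add: dil_gamma_def chebU_dil_eq_chebU algebra_simps smult_diff_left diff_divide_distrib
        smult_add_right smult_diff_right)
next
  case (3 k)
  have "chebU_dil lam (Suc s) (Suc (Suc (s + Suc (Suc k))))
      = [:0, 1:] * chebU_dil lam (Suc s) (Suc (Suc (s + Suc k)))
        - smult (1/4) (chebU_dil lam (Suc s) (Suc (Suc (s + k))))"
    by (simp only: add_Suc_right chebU_dil.simps) (simp add: dil_gamma_def)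
  also have "\<dots> = ([:0, 1:] * chebU (Suc (Suc (s + Suc k))) - smult (1/4) (chebU (Suc (Suc (s + k)))))
        + smult ((1 - lam) / 4) (chebU s * ([:0, 1:] * chebU (Suc k) - smult (1/4) (chebU k)))"
    unfolding 3
    by (simp del: chebU.simps add: algebra_simps smult_add_right smult_diff_right)
  also have "\<dots> = chebU (Suc (Suc (s + Suc (Suc k))))
        + smult ((1 - lam) / 4) (chebU s * chebU (Suc (Suc k)))"
    by (simp only: chebU.simps add_Suc_right)
  finally show ?case .
qed

text \<open>For \<open>n < r\<close> the truncated difference \<open>n - r\<close> makes the sum empty.\<close>

lemma chebU_dil_expansion:
  assumes "r \<ge> 1"
  shows "chebU_dil lam r n = chebU n
    + (\<Sum>i\<in>{1..min r (n - r)}. smult ((1 - lam) / 4 ^ i) (chebU (n - 2 * i)))"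
proof (cases "n \<le> r")
  case True
  then show ?thesis by (simp add: chebU_dil_eq_chebU)
next
  case False
  obtain s where r: "r = Suc s"
    using assms by (cases r) auto
  obtain k where n: "n = Suc (Suc (s + k))"
    using False r less_iff_Suc_add[of r n] by auto
  have m: "min r (n - r) = Suc (min s k)"
    unfolding r n by simp
  \<comment> \<open>The prefactor \<open>1/4\<close> merges with \<open>1 / 4 ^ j\<close>, and
    \<open>s + k = n - 2\<close>, so everything depends on \<open>Suc j\<close>, which becomes
    \<open>i\<close> below.\<close>
  have "smult ((1 - lam) / 4) (chebU s * chebU k)
      = (\<Sum>j\<in>{0..min s k}. smult ((1 - lam) / 4 ^ Suc j) (chebU (n - 2 * Suc j)))"
    unfolding chebU_mult smult_sum_poly n by (simp add: atMost_atLeast0)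
  also have "\<dots> = (\<Sum>i\<in>{1..min r (n - r)}. smult ((1 - lam) / 4 ^ i) (chebU (n - 2 * i)))"
    unfolding m One_nat_def sum.shift_bounds_cl_Suc_ivl ..
  finally show ?thesis
    using chebU_dil_eq_product[of lam s k] by (simp only: r n)
qed

lemma degree_chebU_le: "degree (chebU n) \<le> n"
proof (induction n rule: chebU.induct)
  case (3 n)
  then show ?case
    by (simp only: chebU.simps)
       (intro degree_diff_le, auto intro: order_trans[OF degree_pCons_le] order_trans[OF degree_smult_le])
qed simp_all

lemma coeff_chebU_self: "coeff (chebU n) n = 1"
proof (induction n rule: chebU.induct)
  case (3 n)
  then show ?case
    using degree_chebU_le[of n] by (simp add: coeff_eq_0)
qed simp_all

text \<open>Triangularity: \<open>chebU m\<close> is monic of degree \<open>m\<close>, so the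
  coefficient of degree \<open>n\<close> isolates \<open>c n\<close>, and induction removes the
  lower terms.\<close>

lemma chebU_independent:
  assumes "(\<Sum>m\<le>n. smult (c m) (chebU m)) = 0" and "m \<le> n"
  shows "c m = 0"
  using assms
proof (induction n arbitrary: m)
  case 0
  then show ?case by simp
next
  case (Suc n)
  have "coeff (chebU k) (Suc n) = 0" if "k \<le> n" for k
    using degree_chebU_le[of k] that by (intro coeff_eq_0) simp
  then have "coeff (\<Sum>m\<le>Suc n. smult (c m) (chebU m)) (Suc n) = c (Suc n)"
    by (simp add: coeff_sum coeff_chebU_self del: chebU.simps)
  then have top: "c (Suc n) = 0"
    unfolding Suc.prems(1) by simp
  then have "(\<Sum>m\<le>n. smult (c m) (chebU m)) = 0"
    using Suc.prems(1) by simp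
  then show ?case
    using Suc.IH Suc.prems(2) top by (cases "m = Suc n") auto
qed

text \<open>Reduces the definite description to exhibiting one expansion: independence gives
  uniqueness up to \<open>n\<close>, the default value \<open>0\<close> beyond it.\<close>

lemma connection_coeff_chebU_eqI:
  assumes "Q n = (\<Sum>m\<le>n. smult (c m) (chebU m))" and "\<And>m. m > n \<Longrightarrow> c m = 0"
  shows "connection_coeff Q chebU n = c"
  unfolding connection_coeff_def
proof (rule the_equality)
  show "Q n = (\<Sum>m\<le>n. smult (c m) (chebU m)) \<and> (\<forall>m>n. c m = 0)"
    using assms by simp
next
  fix d assume d: "Q n = (\<Sum>m\<le>n. smult (d m) (chebU m)) \<and> (\<forall>m>n. d m = 0)"
  then have z: "(\<Sum>m\<le>n. smult (d m - c m) (chebU m)) = 0"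
    using assms(1) by (simp add: smult_diff_left sum_subtractf)
  show "d = c"
  proof
    fix m
    show "d m = c m"
      using chebU_independent[OF z, of m] d assms(2)[of m] by (cases "m \<le> n") auto
  qed
qed

text \<open>Indicator form of the expansion above, chosen so that exchanging the two sums recovers
  it term by term. In the range of \<open>i\<close>, \<open>2 * i \<le> n\<close>, so at most one
  indicator fires.\<close>

definition dil_coeff :: "complex \<Rightarrow> nat \<Rightarrow> nat \<Rightarrow> nat \<Rightarrow> complex" where
  "dil_coeff lam r n m = (if m = n then 1 else 0)
     + (\<Sum>i\<in>{1..min r (n - r)}. if m = n - 2 * i then (1 - lam) / 4 ^ i else 0)"

lemma chebU_dil_eq_sum_dil_coeff:
  assumes "r \<ge> 1"
  shows "chebU_dil lam r n = (\<Sum>m\<le>n. smult (dil_coeff lam r n m) (chebU m))"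
proof -
  have delta: "(\<Sum>m\<le>n. smult (if m = k then a else 0) (chebU m)) = smult a (chebU k)"
    if "k \<le> n" for k and a :: complex
  proof -
    have "(\<Sum>m\<le>n. smult (if m = k then a else 0) (chebU m))
        = (\<Sum>m\<le>n. if m = k then smult a (chebU m) else 0)"
      by (intro sum.cong) auto
    then show ?thesis using that by simp
  qed
  have "(\<Sum>m\<le>n. smult (dil_coeff lam r n m) (chebU m))
      = (\<Sum>m\<le>n. smult (if m = n then 1 else 0) (chebU m))
        + (\<Sum>m\<le>n. \<Sum>i\<in>{1..min r (n - r)}.
            smult (if m = n - 2 * i then (1 - lam) / 4 ^ i else 0) (chebU m))"
    by (simp only: dil_coeff_def smult_add_left smult_sum sum.distrib)
  also have "\<dots> = chebU n
      + (\<Sum>i\<in>{1..min r (n - r)}. smult ((1 - lam) / 4 ^ i) (chebU (n - 2 * i)))"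
    by (subst sum.swap) (simp only: delta diff_le_self order_refl smult_1_left)
  finally show ?thesis
    using chebU_dil_expansion[OF assms] by simp
qed

lemma connection_coeff_chebU_dil:
  assumes "r \<ge> 1"
  shows "connection_coeff (chebU_dil lam r) chebU n = dil_coeff lam r n"
proof (rule connection_coeff_chebU_eqI)
  show "chebU_dil lam r n = (\<Sum>m\<le>n. smult (dil_coeff lam r n m) (chebU m))"
    by (rule chebU_dil_eq_sum_dil_coeff[OF assms])
qed (auto simp: dil_coeff_def intro!: sum.neutral)

lemma dil_coeff_self: "dil_coeff lam r n n = 1"
proof -
  have "n \<noteq> n - 2 * i" if "i \<in> {1..min r (n - r)}" for i
    using that by auto
  then show ?thesis
    by (simp add: dil_coeff_def)
qed

text \<open>A common criterion for all zeros: odd diagonals, even diagonals with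
  \<open>n < r + i\<close>, and diagonals beyond \<open>2 * r\<close>.\<close>

lemma dil_coeff_eq_0:
  assumes "1 \<le> d" "d \<le> n" "\<And>i. 1 \<le> i \<Longrightarrow> i \<le> r \<Longrightarrow> r + i \<le> n \<Longrightarrow> d \<noteq> 2 * i"
  shows "dil_coeff lam r n (n - d) = 0"
proof -
  have "n - d \<noteq> n - 2 * i" if "i \<in> {1..min r (n - r)}" for i
  proof -
    \<comment> \<open>These bounds give \<open>2 * i \<le> n\<close>, so neither subtraction
      truncates and equality would force \<open>d = 2 * i\<close>.\<close>
    have "1 \<le> i" "i \<le> r" "r + i \<le> n"
      using that by auto
    with assms(3)[of i] assms(2) show ?thesis by linarith
  qed
  then show ?thesis
    using assms(1,2) by (simp add: dil_coeff_def)
qed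

lemma dil_coeff_even:
  assumes "1 \<le> i" "i \<le> r" "r + i \<le> n"
  shows "dil_coeff lam r n (n - 2 * i) = (1 - lam) / 4 ^ i"
proof -
  \<comment> \<open>Without truncation \<open>n - 2 * j\<close> is injective in \<open>j\<close>, so
    only \<open>j = i\<close> survives.\<close>
  have "(\<Sum>j\<in>{1..min r (n - r)}. if n - 2 * i = n - 2 * j then (1 - lam) / 4 ^ j else 0)
      = (\<Sum>j\<in>{1..min r (n - r)}. if j = i then (1 - lam) / 4 ^ j else 0)"
    using assms by (intro sum.cong) auto
  moreover have "n - 2 * i \<noteq> n" "i \<in> {1..min r (n - r)}"
    using assms by auto
  ultimately show ?thesis
    by (simp add: dil_coeff_def)
qed

theorem theorem3p4:
  fixes r :: nat and lam :: complex and cc :: "nat \<Rightarrow> nat \<Rightarrow> complex"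
  assumes "r \<ge> 1" and "lam \<noteq> 0" and "lam \<noteq> 1"
  defines "cc \<equiv> connection_coeff (chebU_dil lam r) chebU"
  shows "(\<forall>n. chebU_dil lam r n = (\<Sum>m\<le>n. smult (cc n m) (chebU m))) \<and>
    (\<forall>n. cc n n = 1) \<and>
    (\<forall>i. 1 \<le> i \<and> i \<le> r \<longrightarrow> (\<forall>n\<ge>2*i-1. cc n (n - (2*i-1)) = 0)) \<and>
    (\<forall>i. 1 \<le> i \<and> i \<le> r \<longrightarrow>
       (\<forall>n. 2*i \<le> n \<and> n < r + i \<longrightarrow> cc n (n - 2*i) = 0) \<and>
       (\<forall>n\<ge>r+i. cc n (n - 2*i) = (1 - lam) / 4^i)) \<and>
    (\<forall>m\<ge>2*r+1. \<forall>n\<ge>m. cc n (n - m) = 0)"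
proof -
  have cc: "cc n = dil_coeff lam r n" for n
    unfolding cc_def using assms(1) by (rule connection_coeff_chebU_dil)
  \<comment> \<open>Odd diagonals vanish by parity; the other zeros follow from linear
    inequalities.\<close>
  have "dil_coeff lam r n (n - (2 * i - 1)) = 0" if "1 \<le> i" "2 * i - 1 \<le> n" for i n
    using that by (intro dil_coeff_eq_0) presburger+
  then show ?thesis
    unfolding cc
    using chebU_dil_eq_sum_dil_coeff[OF assms(1)]
    by (auto simp del: One_nat_def intro!: dil_coeff_self dil_coeff_eq_0 dil_coeff_even)
qed

end
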